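(* Let $A$ be a (unital, not necessarily associative) ring with involution $*$, let $\alpha$ be an invertible symmetric ($\alpha^*=\alpha$) element of the center of $A$, and let $R=(A,\alpha)$ be the ring obtained from $A$ by the Cayley-Dickson process. Put $C=Z(A)$ and $I=\operatorname{Ann}_C([A,A])$. Then: (1) $N(R)=\{(x,y) : x\in C,\ y\in I\}$. (2) The ring $R$ is left $N$-essential (respectively, right $N$-essential) if and only if $A$ is a centrally essential ring and $I$ is an essential ideal of the ring $C$.
   Context: All rings are unital but not necessarily associative. An involution $*$ of a ring $A$ is an additive map with $(ab)^*=b^*a^*$ and $(a^* )^*=a$. For a ring $R$, $(a,b,c)=(ab)c-a(bc)$ is the associator and $[a,b]=ab-ba$ the commutator. The associative center is $N(R)=\{x\in R : (x,a,b)=(a,x,b)=(a,b,x)=0\ \forall a,b\in R\}$, the commutative center is $K(R)=\{x\in R : [x,a]=0\ \forall a\in R\}$, and the center is $Z(R)=N(R)\cap K(R)$. $N(R)$ and $Z(R)$ are subrings of $R$. $[A,A]$ denotes the (two-sided) ideal of $A$ generated by the commutators of all its elements. $\operatorname{Ann}_C(S)=\{c\in C : cS=0\}$. Cayley-Dickson process: $(A,\alpha)$ is the abelian group $A\oplus A$ with multiplication $$(a_1,a_2)(a_3,a_4)=(a_1a_3+\alpha a_4a_2^*,\ a_1^*a_4+a_3a_2).$$ A ring $R$ is centrally essential if $Z(R)r\cap Z(R)\neq 0$ for every nonzero $r\in R$. It is left $N$-essential if $N(R)r\cap N(R)\neq 0$ for every nonzero $r\in R$, and right $N$-essential if $rN(R)\cap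 N(R)\neq 0$ for every nonzero $r\in R$. An ideal of a commutative ring is essential if it has nonzero intersection with every nonzero ideal. *)

theory Defs
  imports "HOL-Algebra.Ideal"
begin

text \<open>HOL-Algebra's \<^locale>\<open>ring\<close> is associative. Here its records are used with a locale that
  drops associativity of multiplication.\<close>

locale nonassoc_ring = abelian_group R for R (structure) +
  assumes m_closed [intro, simp]: "\<lbrakk>x \<in> carrier R; y \<in> carrier R\<rbrakk> \<Longrightarrow> x \<otimes> y \<in> carrier R"
    and one_closed [intro, simp]: "\<one> \<in> carrier R"
    and l_one [simp]: "x \<in> carrier R \<Longrightarrow> \<one> \<otimes> x = x"
    and r_one [simp]: "x \<in> carrier R \<Longrightarrow> x \<otimes> \<one> = x"
    and l_distr: "\<lbrakk>x \<in> carrier R; y \<in> carrier R; z \<in> carrier R\<rbrakk>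
      \<Longrightarrow> (x \<oplus> y) \<otimes> z = x \<otimes> z \<oplus> y \<otimes> z"
    and r_distr: "\<lbrakk>x \<in> carrier R; y \<in> carrier R; z \<in> carrier R\<rbrakk>
      \<Longrightarrow> z \<otimes> (x \<oplus> y) = z \<otimes> x \<oplus> z \<otimes> y"

locale involutive_ring = nonassoc_ring A for A (structure) +
  fixes star :: "'a \<Rightarrow> 'a"
  assumes star_closed [intro, simp]: "a \<in> carrier A \<Longrightarrow> star a \<in> carrier A"
    and star_add: "\<lbrakk>a \<in> carrier A; b \<in> carrier A\<rbrakk> \<Longrightarrow> star (a \<oplus> b) = star a \<oplus> star b"
    and star_mult: "\<lbrakk>a \<in> carrier A; b \<in> carrier A\<rbrakk> \<Longrightarrow> star (a \<otimes> b) = star b \<otimes> star a"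
    and star_star [simp]: "a \<in> carrier A \<Longrightarrow> star (star a) = a"

definition associator :: "('a, 'm) ring_scheme \<Rightarrow> 'a \<Rightarrow> 'a \<Rightarrow> 'a \<Rightarrow> 'a" where
  "associator R a b c = (a \<otimes>\<^bsub>R\<^esub> b) \<otimes>\<^bsub>R\<^esub> c \<ominus>\<^bsub>R\<^esub> a \<otimes>\<^bsub>R\<^esub> (b \<otimes>\<^bsub>R\<^esub> c)"

definition commutator :: "('a, 'm) ring_scheme \<Rightarrow> 'a \<Rightarrow> 'a \<Rightarrow> 'a" where
  "commutator R a b = a \<otimes>\<^bsub>R\<^esub> b \<ominus>\<^bsub>R\<^esub> b \<otimes>\<^bsub>R\<^esub> a"

definition assoc_center :: "('a, 'm) ring_scheme \<Rightarrow> 'a set" where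
  "assoc_center R = {x \<in> carrier R. \<forall>a\<in>carrier R. \<forall>b\<in>carrier R.
     associator R x a b = \<zero>\<^bsub>R\<^esub> \<and> associator R a x b = \<zero>\<^bsub>R\<^esub> \<and> associator R a b x = \<zero>\<^bsub>R\<^esub>}"

definition comm_center :: "('a, 'm) ring_scheme \<Rightarrow> 'a set" where
  "comm_center R = {x \<in> carrier R. \<forall>a\<in>carrier R. commutator R x a = \<zero>\<^bsub>R\<^esub>}"

definition center :: "('a, 'm) ring_scheme \<Rightarrow> 'a set" where
  "center R = assoc_center R \<inter> comm_center R"

definition center_ring :: "('a, 'm) ring_scheme \<Rightarrow> ('a, 'm) ring_scheme" where
  "center_ring R = R\<lparr>carrier := center R\<rparr>"

text \<open>HOL-Algebra's \<^locale>\<open>ideal\<close> and \<^const>\<open>genideal\<close> presuppose an associative ring, so for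
  ideals of a nonassociative ring they have to be replaced.\<close>

definition nonassoc_ideal :: "'a set \<Rightarrow> ('a, 'm) ring_scheme \<Rightarrow> bool" where
  "nonassoc_ideal J R \<longleftrightarrow> additive_subgroup J R \<and>
     (\<forall>a\<in>J. \<forall>x\<in>carrier R. x \<otimes>\<^bsub>R\<^esub> a \<in> J \<and> a \<otimes>\<^bsub>R\<^esub> x \<in> J)"

definition commutator_ideal :: "('a, 'm) ring_scheme \<Rightarrow> 'a set" where
  "commutator_ideal R = \<Inter>{J. nonassoc_ideal J R \<and>
     {commutator R a b | a b. a \<in> carrier R \<and> b \<in> carrier R} \<subseteq> J}"

definition annihilator :: "('a, 'm) ring_scheme \<Rightarrow> 'a set \<Rightarrow> 'a set \<Rightarrow> 'a set" where
  "annihilator R C S = {c \<in> C. \<forall>s\<in>S. c \<otimes>\<^bsub>R\<^esub> s = \<zero>\<^bsub>R\<^esub>}"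

text \<open>The parameter is central in all uses, so the bracketing of the triple product is immaterial.\<close>

definition cayley_dickson ::
  "('a, 'm) ring_scheme \<Rightarrow> ('a \<Rightarrow> 'a) \<Rightarrow> 'a \<Rightarrow> ('a \<times> 'a) ring" where
  "cayley_dickson A star \<alpha> =
     \<lparr>carrier = carrier A \<times> carrier A,
      mult = (\<lambda>(a1, a2) (a3, a4).
        (a1 \<otimes>\<^bsub>A\<^esub> a3 \<oplus>\<^bsub>A\<^esub> \<alpha> \<otimes>\<^bsub>A\<^esub> a4 \<otimes>\<^bsub>A\<^esub> star a2, star a1 \<otimes>\<^bsub>A\<^esub> a4 \<oplus>\<^bsub>A\<^esub> a3 \<otimes>\<^bsub>A\<^esub> a2)),
      one = (\<one>\<^bsub>A\<^esub>, \<zero>\<^bsub>A\<^esub>),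
      zero = (\<zero>\<^bsub>A\<^esub>, \<zero>\<^bsub>A\<^esub>),
      add = (\<lambda>(a1, a2) (b1, b2). (a1 \<oplus>\<^bsub>A\<^esub> b1, a2 \<oplus>\<^bsub>A\<^esub> b2))\<rparr>"

lemma (in involutive_ring) nonassoc_ring_cayley_dickson:
  assumes \<alpha>: "\<alpha> \<in> center A"
  shows "nonassoc_ring (cayley_dickson A star \<alpha>)"
proof -
  have \<alpha>c: "\<alpha> \<in> carrier A"
    using \<alpha> by (simp add: center_def assoc_center_def)
  have z: "\<zero> \<otimes> x = \<zero>" "x \<otimes> \<zero> = \<zero>" if "x \<in> carrier A" for x
  proof -
    have "\<zero> \<otimes> x \<oplus> \<zero> \<otimes> x = \<zero> \<otimes> x" "x \<otimes> \<zero> \<oplus> x \<otimes> \<zero> = x \<otimes> \<zero>"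
      using that l_distr[of \<zero> \<zero> x] r_distr[of \<zero> \<zero> x] by simp_all
    then show "\<zero> \<otimes> x = \<zero>" "x \<otimes> \<zero> = \<zero>"
      using that by (simp_all only: add.l_cancel_one m_closed zero_closed)
  qed
  have s0: "star \<zero> = \<zero>"
  proof -
    have "star \<zero> \<oplus> star \<zero> = star \<zero>"
      using star_add[of \<zero> \<zero>] by simp
    then show ?thesis
      by (simp only: add.l_cancel_one star_closed zero_closed)
  qed
  have s1: "star \<one> = \<one>"
    using star_mult[of "star \<one>" \<one>] by simp
  have "abelian_group (cayley_dickson A star \<alpha>)"
  proof (rule abelian_groupI)
    fix x assume "x \<in> carrier (cayley_dickson A star \<alpha>)"
    then show "\<exists>y\<in>carrier (cayley_dickson A star \<alpha>).
        y \<oplus>\<^bsub>cayley_dickson A star \<alpha>\<^esub> x = \<zero>\<^bsub>cayley_dickson A star \<alpha>\<^esub>"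
      by (intro bexI[of _ "(\<ominus> fst x, \<ominus> snd x)"]) (auto simp: cayley_dickson_def l_neg)
  qed (auto simp: cayley_dickson_def a_ac)
  then show ?thesis
    by (rule nonassoc_ring.intro, unfold_locales)
      (auto simp: cayley_dickson_def \<alpha>c z s0 s1 l_distr r_distr star_add a_ac)
qed

definition centrally_essential :: "('a, 'm) ring_scheme \<Rightarrow> bool" where
  "centrally_essential R \<longleftrightarrow> (\<forall>r\<in>carrier R. r \<noteq> \<zero>\<^bsub>R\<^esub> \<longrightarrow>
     (\<lambda>z. z \<otimes>\<^bsub>R\<^esub> r) ` center R \<inter> center R \<noteq> {\<zero>\<^bsub>R\<^esub>})"

definition left_N_essential :: "('a, 'm) ring_scheme \<Rightarrow> bool" where
  "left_N_essential R \<longleftrightarrow> (\<forall>r\<in>carrier R. r \<noteq> \<zero>\<^bsub>R\<^esub> \<longrightarrow>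
     (\<lambda>n. n \<otimes>\<^bsub>R\<^esub> r) ` assoc_center R \<inter> assoc_center R \<noteq> {\<zero>\<^bsub>R\<^esub>})"

definition right_N_essential :: "('a, 'm) ring_scheme \<Rightarrow> bool" where
  "right_N_essential R \<longleftrightarrow> (\<forall>r\<in>carrier R. r \<noteq> \<zero>\<^bsub>R\<^esub> \<longrightarrow>
     (\<lambda>n. r \<otimes>\<^bsub>R\<^esub> n) ` assoc_center R \<inter> assoc_center R \<noteq> {\<zero>\<^bsub>R\<^esub>})"

definition essential_ideal :: "'a set \<Rightarrow> ('a, 'm) ring_scheme \<Rightarrow> bool" where
  "essential_ideal I R \<longleftrightarrow> cring R \<and> ideal I R \<and>
     (\<forall>J. ideal J R \<and> J \<noteq> {\<zero>\<^bsub>R\<^esub>} \<longrightarrow> I \<inter> J \<noteq> {\<zero>\<^bsub>R\<^esub>})"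

end

theory Submission
  imports Defs
begin

text \<open>
  Evaluating associators of \<open>R\<close> on the two summands shows that \<open>(x, y)\<close> is in the associative center
  iff \<open>x\<close> is central in \<open>A\<close>, \<open>y\<close> is central in \<open>A\<close>, and \<open>y (a b) = y (b a)\<close> for all \<open>a\<close>, \<open>b\<close>;
  the last condition says that \<open>y\<close> kills the commutator ideal, because the elements killed by
  a central element form an ideal.

  If \<open>R\<close> is \<open>N\<close>-essential, testing it on \<open>(a, 0)\<close> gives central essentiality of \<open>A\<close> and testing
  it on \<open>(0, j)\<close> gives essentiality of \<open>I\<close>. Conversely, every nonzero \<open>a\<close> has a
  central multiple \<open>e a\<close> that is a nonzero element of \<open>I\<close>; doing this successively in the two
  components moves \<open>(a, b)\<close> into \<open>C \<times> I\<close> by an element \<open>(e, 0)\<close>.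
\<close>

section \<open>Arithmetic and the center of a nonassociative ring\<close>

context nonassoc_ring
begin

lemma mult_zero [simp]:
  assumes "x \<in> carrier R"
  shows "\<zero> \<otimes> x = \<zero>" and "x \<otimes> \<zero> = \<zero>"
proof -
  have "\<zero> \<otimes> x \<oplus> \<zero> \<otimes> x = \<zero> \<otimes> x" "x \<otimes> \<zero> \<oplus> x \<otimes> \<zero> = x \<otimes> \<zero>"
    using assms l_distr[of \<zero> \<zero> x] r_distr[of \<zero> \<zero> x] by simp_all
  then show "\<zero> \<otimes> x = \<zero>" "x \<otimes> \<zero> = \<zero>"
    using assms by (simp_all only: add.l_cancel_one m_closed zero_closed)
qed

lemma mult_minus:
  assumes "x \<in> carrier R" "y \<in> carrier R"
  shows "(\<ominus> x) \<otimes> y = \<ominus> (x \<otimes> y)" and "x \<otimes> (\<ominus> y) = \<ominus> (x \<otimes> y)"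
proof -
  have "(\<ominus> x) \<otimes> y \<oplus> x \<otimes> y = \<zero>" "x \<otimes> (\<ominus> y) \<oplus> x \<otimes> y = \<zero>"
    using assms by (simp_all add: l_distr[symmetric] r_distr[symmetric] l_neg)
  then show "(\<ominus> x) \<otimes> y = \<ominus> (x \<otimes> y)" "x \<otimes> (\<ominus> y) = \<ominus> (x \<otimes> y)"
    using assms by (metis m_closed a_inv_closed minus_equality)+
qed

lemma minus_eq_zero_iff [simp]:
  assumes "x \<in> carrier R" "y \<in> carrier R"
  shows "x \<ominus> y = \<zero> \<longleftrightarrow> x = y"
  using assms by (metis a_minus_def a_inv_closed minus_equality minus_minus r_neg)

lemma assoc_center_iff:
  "x \<in> assoc_center R \<longleftrightarrow> x \<in> carrier R \<and> (\<forall>a\<in>carrier R. \<forall>b\<in>carrier R.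
    (x \<otimes> a) \<otimes> b = x \<otimes> (a \<otimes> b) \<and> (a \<otimes> x) \<otimes> b = a \<otimes> (x \<otimes> b) \<and> (a \<otimes> b) \<otimes> x = a \<otimes> (b \<otimes> x))"
  by (auto simp: assoc_center_def associator_def)

text \<open>Once \<open>x\<close> commutes with everything, the three associator conditions reduce
  to two: \<open>(a x) b = a (x b)\<close> turns into \<open>a (x b) = x (a b)\<close>, and the
  condition with \<open>x\<close> in the last place follows from the others. The equations are
  oriented so that rewriting moves a central factor to the front and brackets to the right.\<close>

lemma center_iff:
  "x \<in> center R \<longleftrightarrow> x \<in> carrier R \<and> (\<forall>a\<in>carrier R. a \<otimes> x = x \<otimes> a) \<and>
    (\<forall>a\<in>carrier R. \<forall>b\<in>carrier R. (x \<otimes> a) \<otimes> b = x \<otimes> (a \<otimes> b) \<and> a \<otimes> (x \<otimes> b) = x \<otimes> (a \<otimes> b))"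
    (is "_ \<longleftrightarrow> ?r")
proof
  assume x: "x \<in> center R"
  then have c: "x \<in> carrier R" "\<And>a. a \<in> carrier R \<Longrightarrow> a \<otimes> x = x \<otimes> a"
    by (auto simp: center_def comm_center_def commutator_def assoc_center_def)
  have "(x \<otimes> a) \<otimes> b = x \<otimes> (a \<otimes> b) \<and> a \<otimes> (x \<otimes> b) = x \<otimes> (a \<otimes> b)"
    if "a \<in> carrier R" "b \<in> carrier R" for a b
  proof -
    have "x \<in> assoc_center R"
      using x by (simp add: center_def)
    then have n: "(x \<otimes> a) \<otimes> b = x \<otimes> (a \<otimes> b)" "(a \<otimes> x) \<otimes> b = a \<otimes> (x \<otimes> b)"
      using that by (auto simp: assoc_center_iff)
    with c(2)[of a] that show ?thesis
      by simp
  qed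
  with c show ?r by blast
next
  assume r: ?r
  then have "x \<in> assoc_center R"
    unfolding assoc_center_iff by (metis m_closed)
  with r show "x \<in> center R"
    by (simp add: center_def comm_center_def commutator_def)
qed

lemma center_closed [simp, intro]: "x \<in> center R \<Longrightarrow> x \<in> carrier R"
  unfolding center_iff by blast

lemma center_comm: "x \<in> center R \<Longrightarrow> a \<in> carrier R \<Longrightarrow> a \<otimes> x = x \<otimes> a"
  unfolding center_iff by blast

lemma center_assoc:
  "x \<in> center R \<Longrightarrow> a \<in> carrier R \<Longrightarrow> b \<in> carrier R \<Longrightarrow> (x \<otimes> a) \<otimes> b = x \<otimes> (a \<otimes> b)"
  unfolding center_iff by blast

lemma center_lcomm:
  "x \<in> center R \<Longrightarrow> a \<in> carrier R \<Longrightarrow> b \<in> carrier R \<Longrightarrow> a \<otimes> (x \<otimes> b) = x \<otimes> (a \<otimes> b)"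
  unfolding center_iff by blast

lemma zero_center [simp]: "\<zero> \<in> center R"
  unfolding center_iff by simp

lemma one_center [simp]: "\<one> \<in> center R"
  unfolding center_iff by simp

lemma add_center [simp]: "x \<in> center R \<Longrightarrow> y \<in> center R \<Longrightarrow> x \<oplus> y \<in> center R"
  unfolding center_iff[of "x \<oplus> y"]
  by (auto simp: l_distr r_distr center_comm[of x] center_comm[of y] center_assoc
      center_lcomm[of x] center_lcomm[of y])

lemma minus_center [simp]: "x \<in> center R \<Longrightarrow> \<ominus> x \<in> center R"
  unfolding center_iff[of "\<ominus> x"]
  by (auto simp: mult_minus center_comm[of x] center_assoc center_lcomm[of x])

lemma mult_center [simp]:
  assumes "x \<in> center R" "y \<in> center R"
  shows "x \<otimes> y \<in> center R"
  unfolding center_iff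
proof (intro conjI ballI)
  show "a \<otimes> (x \<otimes> y) = x \<otimes> y \<otimes> a" if "a \<in> carrier R" for a
    using assms that by (simp add: center_lcomm[of x] center_assoc[of x] center_comm[of y a])
  fix a b assume ab: "a \<in> carrier R" "b \<in> carrier R"
  show "x \<otimes> y \<otimes> a \<otimes> b = x \<otimes> y \<otimes> (a \<otimes> b)"
    using assms ab by (simp add: center_assoc)
  show "a \<otimes> (x \<otimes> y \<otimes> b) = x \<otimes> y \<otimes> (a \<otimes> b)"
    using assms ab by (simp add: center_assoc center_lcomm[of x a] center_lcomm[of y a])
qed (use assms in simp)

lemma cring_center_ring: "cring (center_ring R)"
proof (rule cringI)
  show "abelian_group (center_ring R)"
  proof (rule abelian_groupI)
    fix x assume "x \<in> carrier (center_ring R)"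
    then show "\<exists>y\<in>carrier (center_ring R). y \<oplus>\<^bsub>center_ring R\<^esub> x = \<zero>\<^bsub>center_ring R\<^esub>"
      by (intro bexI[of _ "\<ominus> x"]) (auto simp: center_ring_def l_neg)
  qed (auto simp: center_ring_def a_ac)
  show "comm_monoid (center_ring R)"
    by (rule comm_monoidI) (auto simp: center_ring_def center_assoc intro: center_comm)
qed (auto simp: center_ring_def l_distr)

section \<open>The annihilator of the commutator ideal\<close>

text \<open>Trades the generated ideal for an identity in two variables, the only form in which
  \<open>I\<close> is computed with below.\<close>

lemma annihilator_commutator_ideal:
  "annihilator R (center R) (commutator_ideal R) =
    {c \<in> center R. \<forall>a\<in>carrier R. \<forall>b\<in>carrier R. c \<otimes> (a \<otimes> b) = c \<otimes> (b \<otimes> a)}"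
proof -
  have comm: "c \<otimes> commutator R a b = \<zero> \<longleftrightarrow> c \<otimes> (a \<otimes> b) = c \<otimes> (b \<otimes> a)"
    if "c \<in> carrier R" "a \<in> carrier R" "b \<in> carrier R" for a b c
    using that minus_eq_zero_iff[of "c \<otimes> (a \<otimes> b)" "c \<otimes> (b \<otimes> a)"]
    by (simp add: commutator_def a_minus_def r_distr mult_minus)
  have mem: "commutator R a b \<in> commutator_ideal R" if "a \<in> carrier R" "b \<in> carrier R" for a b
    using that by (auto simp: commutator_ideal_def)
  have ann: "c \<otimes> s = \<zero>" if c: "c \<in> center R" and s: "s \<in> commutator_ideal R"
    and k: "\<forall>a\<in>carrier R. \<forall>b\<in>carrier R. c \<otimes> (a \<otimes> b) = c \<otimes> (b \<otimes> a)" for c s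
  proof -
    \<comment> \<open>Centrality of \<open>c\<close> makes this an ideal:
      \<open>c (x a) = x (c a)\<close> and \<open>c (a x) = (c a) x\<close>. As it contains all
      commutators, it contains the ideal they generate.\<close>
    let ?J = "{s \<in> carrier R. c \<otimes> s = \<zero>}"
    have "additive_subgroup ?J R"
      using c by (intro additive_subgroup.intro add.subgroupI)
        (auto simp: r_distr mult_minus simp flip: a_inv_def)
    moreover have "c \<otimes> (x \<otimes> a) = \<zero>" "c \<otimes> (a \<otimes> x) = \<zero>"
      if "a \<in> ?J" "x \<in> carrier R" for a x
      using c that by (auto simp: center_lcomm[of c x a, symmetric] center_assoc[of c a x, symmetric])
    ultimately have "nonassoc_ideal ?J R"
      unfolding nonassoc_ideal_def by blast
    moreover have "{commutator R a b | a b. a \<in> carrier R \<and> b \<in> carrier R} \<subseteq> ?J"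
    proof safe
      fix a b assume ab: "a \<in> carrier R" "b \<in> carrier R"
      then show "commutator R a b \<in> carrier R"
        by (simp add: commutator_def)
      show "c \<otimes> commutator R a b = \<zero>"
        using c k ab comm[of c a b] by simp
    qed
    ultimately show ?thesis
      using s unfolding commutator_ideal_def by blast
  qed
  show ?thesis
    unfolding annihilator_def
  proof (intro Collect_cong conj_cong refl iffI ballI)
    fix c a b
    assume "c \<in> center R" "\<forall>s\<in>commutator_ideal R. c \<otimes> s = \<zero>" "a \<in> carrier R" "b \<in> carrier R"
    then show "c \<otimes> (a \<otimes> b) = c \<otimes> (b \<otimes> a)"
      using mem[of a b] comm[of c a b] by simp
  qed (rule ann)
qed

lemma ideal_annihilator_commutator_ideal:
  "ideal (annihilator R (center R) (commutator_ideal R)) (center_ring R)"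
proof -
  interpret C: cring "center_ring R" by (rule cring_center_ring)
  \<comment> \<open>The additive inverse is defined relative to the carrier, so its agreement with
    that of \<open>R\<close> has to be shown.\<close>
  have inv: "\<ominus>\<^bsub>center_ring R\<^esub> x = \<ominus> x" if "x \<in> center R" for x
    using that by (intro C.minus_equality) (auto simp: center_ring_def l_neg)
  show ?thesis
    unfolding annihilator_commutator_ideal
  proof (rule idealI[OF C.ring_axioms])
    show "subgroup {c \<in> center R. \<forall>a\<in>carrier R. \<forall>b\<in>carrier R. c \<otimes> (a \<otimes> b) = c \<otimes> (b \<otimes> a)}
      (add_monoid (center_ring R))"
    proof (rule C.add.subgroupI)
      show "\<ominus>\<^bsub>center_ring R\<^esub> x \<in> {c \<in> center R. \<forall>a\<in>carrier R. \<forall>b\<in>carrier R. c \<otimes> (a \<otimes> b) = c \<otimes> (b \<otimes> a)}"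
        if "x \<in> {c \<in> center R. \<forall>a\<in>carrier R. \<forall>b\<in>carrier R. c \<otimes> (a \<otimes> b) = c \<otimes> (b \<otimes> a)}" for x
        using that by (auto simp: inv mult_minus)
    qed (auto simp: center_ring_def l_distr intro!: exI[of _ \<zero>])
    fix c x assume "c \<in> {c \<in> center R. \<forall>a\<in>carrier R. \<forall>b\<in>carrier R. c \<otimes> (a \<otimes> b) = c \<otimes> (b \<otimes> a)}"
      and "x \<in> carrier (center_ring R)"
    then have x: "x \<in> center R" and c: "c \<in> center R"
      "\<And>a b. a \<in> carrier R \<Longrightarrow> b \<in> carrier R \<Longrightarrow> c \<otimes> (a \<otimes> b) = c \<otimes> (b \<otimes> a)"
      by (simp_all add: center_ring_def)
    have "(x \<otimes> c) \<otimes> (a \<otimes> b) = (x \<otimes> c) \<otimes> (b \<otimes> a)" if "a \<in> carrier R" "b \<in> carrier R" for a b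
      using x c that by (simp add: center_assoc[of x])
    then show "x \<otimes>\<^bsub>center_ring R\<^esub> c \<in> {c \<in> center R. \<forall>a\<in>carrier R. \<forall>b\<in>carrier R. c \<otimes> (a \<otimes> b) = c \<otimes> (b \<otimes> a)}"
      and "c \<otimes>\<^bsub>center_ring R\<^esub> x \<in> {c \<in> center R. \<forall>a\<in>carrier R. \<forall>b\<in>carrier R. c \<otimes> (a \<otimes> b) = c \<otimes> (b \<otimes> a)}"
      using x c(1) center_comm[of x c] by (simp_all add: center_ring_def)
  qed
qed

text \<open>First \<open>c\<close> moves \<open>a\<close> to a nonzero element of the center; then
  the principal ideal of the center generated by \<open>c a\<close> meets \<open>I\<close>, which
  gives a further factor \<open>d\<close>. The witness is \<open>d c\<close>.\<close>

lemma essential_multiple: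
  assumes ce: "centrally_essential R" and ess: "essential_ideal I (center_ring R)"
    and a: "a \<in> carrier R" "a \<noteq> \<zero>"
  obtains e where "e \<in> center R" "e \<otimes> a \<in> I" "e \<otimes> a \<noteq> \<zero>"
proof -
  interpret C: cring "center_ring R" by (rule cring_center_ring)
  obtain c where c: "c \<in> center R" "c \<otimes> a \<in> center R" "c \<otimes> a \<noteq> \<zero>"
  proof -
    \<comment> \<open>An intersection different from \<open>{0}\<close> could still be empty; since
      it contains zero, it must contain a nonzero element.\<close>
    have "\<zero> \<in> (\<lambda>z. z \<otimes> a) ` center R \<inter> center R"
      using a by (auto intro!: image_eqI[of _ _ \<zero>])
    then show ?thesis
      using ce a that unfolding centrally_essential_def by blast
  qed
  let ?J = "PIdl\<^bsub>center_ring R\<^esub> (c \<otimes> a)"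
  have J: "ideal ?J (center_ring R)"
    using c by (intro C.cgenideal_ideal) (simp add: center_ring_def)
  have "c \<otimes> a \<in> ?J"
    using c C.cgenideal_self[of "c \<otimes> a"] by (simp add: center_ring_def)
  then have "I \<inter> ?J \<noteq> {\<zero>}"
    using ess J c(3) by (auto simp: essential_ideal_def center_ring_def)
  moreover have "\<zero> \<in> I \<inter> ?J"
    using ess J additive_subgroup.zero_closed[OF ideal.axioms(1)]
    by (fastforce simp: essential_ideal_def center_ring_def)
  ultimately obtain m where "m \<in> I" "m \<in> ?J" "m \<noteq> \<zero>" by blast
  then obtain d where "d \<in> center R" "d \<otimes> (c \<otimes> a) \<in> I" "d \<otimes> (c \<otimes> a) \<noteq> \<zero>"
    by (auto simp: cgenideal_def center_ring_def)
  then show ?thesis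
    using c a that[of "d \<otimes> c"] by (simp add: center_assoc)
qed

end

section \<open>The center and the annihilator are stable under the involution\<close>

context involutive_ring
begin

lemma star_zero [simp]: "star \<zero> = \<zero>"
proof -
  have "star \<zero> \<oplus> star \<zero> = star \<zero>"
    using star_add[of \<zero> \<zero>] by simp
  then show ?thesis
    by (simp only: add.l_cancel_one star_closed zero_closed)
qed

lemma star_eq_zero [simp]: "a \<in> carrier A \<Longrightarrow> star a = \<zero> \<longleftrightarrow> a = \<zero>"
  by (metis star_star star_zero)

lemma star_center [simp]:
  assumes "x \<in> center A"
  shows "star x \<in> center A"
proof -
  have "a \<otimes> star x = star x \<otimes> a" if "a \<in> carrier A" for a
    using assms that center_comm[of x "star a"] by (metis center_closed star_closed star_mult star_star)
  moreover have "(star x \<otimes> a) \<otimes> b = star x \<otimes> (a \<otimes> b)" "a \<otimes> (star x \<otimes> b) = star x \<otimes> (a \<otimes> b)"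
    if "a \<in> carrier A" "b \<in> carrier A" for a b
  proof -
    \<comment> \<open>Applying \<open>star\<close> reverses the products and turns the desired
      identities into identities for \<open>x\<close> itself; \<open>star\<close> is
      injective.\<close>
    have "star ((star x \<otimes> a) \<otimes> b) = star (star x \<otimes> (a \<otimes> b))"
      "star (a \<otimes> (star x \<otimes> b)) = star (star x \<otimes> (a \<otimes> b))"
      using assms that by (simp_all add: star_mult center_comm[of x] center_assoc[of x] center_lcomm[of x])
    then show "(star x \<otimes> a) \<otimes> b = star x \<otimes> (a \<otimes> b)" "a \<otimes> (star x \<otimes> b) = star x \<otimes> (a \<otimes> b)"
      using assms that by (metis center_closed star_closed m_closed star_star)+
  qed
  ultimately show ?thesis
    using assms unfolding center_iff[of "star x"] by simp
qed

text \<open>Applying \<open>star\<close> to the identity for \<open>y\<close> at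
  \<open>star b\<close>, \<open>star a\<close> gives \<open>(a b) (star y) = (b a) (star y)\<close>,
  and \<open>star y\<close> is central.\<close>

lemma star_annihilator_commutator_ideal:
  assumes "y \<in> annihilator A (center A) (commutator_ideal A)"
  shows "star y \<in> annihilator A (center A) (commutator_ideal A)"
proof -
  have y: "y \<in> center A" "\<And>a b. a \<in> carrier A \<Longrightarrow> b \<in> carrier A \<Longrightarrow> y \<otimes> (a \<otimes> b) = y \<otimes> (b \<otimes> a)"
    using assms unfolding annihilator_commutator_ideal by blast+
  have "star y \<otimes> (a \<otimes> b) = star y \<otimes> (b \<otimes> a)" if "a \<in> carrier A" "b \<in> carrier A" for a b
  proof -
    have "star (y \<otimes> (star b \<otimes> star a)) = star (y \<otimes> (star a \<otimes> star b))"
      using that by (simp only: y(2) star_closed)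
    then show ?thesis
      using y(1) that by (simp add: star_mult center_comm[of "star y"])
  qed
  then show ?thesis
    using y(1) by (simp add: annihilator_commutator_ideal)
qed

end

section \<open>The Cayley-Dickson ring\<close>

locale cayley_dickson_process = involutive_ring +
  fixes \<alpha>
  assumes \<alpha>_center: "\<alpha> \<in> center A" and \<alpha>_Units: "\<alpha> \<in> Units A" and star_\<alpha>: "star \<alpha> = \<alpha>"
begin

abbreviation "R \<equiv> cayley_dickson A star \<alpha>"
abbreviation "C \<equiv> center A"
abbreviation "I \<equiv> annihilator A C (commutator_ideal A)"

sublocale R: nonassoc_ring R
  by (rule nonassoc_ring_cayley_dickson[OF \<alpha>_center])

lemma \<alpha>_closed [simp]: "\<alpha> \<in> carrier A"
  using \<alpha>_center by blast

lemma \<alpha>_mult_eq_iff [simp]: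
  assumes "x \<in> carrier A" "y \<in> carrier A"
  shows "\<alpha> \<otimes> x = \<alpha> \<otimes> y \<longleftrightarrow> x = y"
proof -
  obtain \<beta> where \<beta>: "\<beta> \<in> carrier A" "\<beta> \<otimes> \<alpha> = \<one>"
    using \<alpha>_Units by (auto simp: Units_def)
  \<comment> \<open>Only the centrality of \<alpha> enters: \<beta> (\<alpha> z) = \<alpha> (\<beta>
    z) = (\<alpha> \<beta>) z = (\<beta> \<alpha>) z.\<close>
  have "\<beta> \<otimes> (\<alpha> \<otimes> z) = z" if "z \<in> carrier A" for z
    using \<beta> that \<alpha>_center by (metis center_assoc center_comm center_lcomm l_one)
  then show ?thesis
    using assms by metis
qed

lemma \<alpha>_mult_eq_zero [simp]: "x \<in> carrier A \<Longrightarrow> \<alpha> \<otimes> x = \<zero> \<longleftrightarrow> x = \<zero>"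
  using \<alpha>_mult_eq_iff[of x \<zero>] by simp

lemma R_carrier: "carrier R = carrier A \<times> carrier A"
  by (simp add: cayley_dickson_def)

lemma R_zero: "\<zero>\<^bsub>R\<^esub> = (\<zero>, \<zero>)"
  by (simp add: cayley_dickson_def)

lemma R_mult:
  assumes "a \<in> carrier A" "b \<in> carrier A" "c \<in> carrier A" "d \<in> carrier A"
  shows "(a, b) \<otimes>\<^bsub>R\<^esub> (c, d) = (a \<otimes> c \<oplus> \<alpha> \<otimes> (d \<otimes> star b), star a \<otimes> d \<oplus> c \<otimes> b)"
  using assms \<alpha>_center by (simp add: cayley_dickson_def center_assoc)

section \<open>The associative center of the Cayley-Dickson ring\<close>

lemma assoc_center_cayley_dickson_subset: "assoc_center R \<subseteq> C \<times> I"
proof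
  fix n assume n: "n \<in> assoc_center R"
  then obtain x y where nxy: "n = (x, y)" and xy: "x \<in> carrier A" "y \<in> carrier A"
    by (cases n) (auto simp: assoc_center_def R_carrier)
  have as: "((x, y) \<otimes>\<^bsub>R\<^esub> a) \<otimes>\<^bsub>R\<^esub> b = (x, y) \<otimes>\<^bsub>R\<^esub> (a \<otimes>\<^bsub>R\<^esub> b)"
    "(a \<otimes>\<^bsub>R\<^esub> (x, y)) \<otimes>\<^bsub>R\<^esub> b = a \<otimes>\<^bsub>R\<^esub> ((x, y) \<otimes>\<^bsub>R\<^esub> b)"
    "(a \<otimes>\<^bsub>R\<^esub> b) \<otimes>\<^bsub>R\<^esub> (x, y) = a \<otimes>\<^bsub>R\<^esub> (b \<otimes>\<^bsub>R\<^esub> (x, y))"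
    if "a \<in> carrier R" "b \<in> carrier R" for a b
    using n that unfolding nxy R.assoc_center_iff by blast+
  \<comment> \<open>First components of the associators give the identities for \<open>x\<close>,
    second components those for \<open>y\<close>.\<close>
  have x1: "(x \<otimes> a) \<otimes> b = x \<otimes> (a \<otimes> b)" "(a \<otimes> x) \<otimes> b = a \<otimes> (x \<otimes> b)"
    and y1: "b \<otimes> (a \<otimes> y) = (a \<otimes> b) \<otimes> y" and y2: "b \<otimes> (star a \<otimes> y) = star a \<otimes> (b \<otimes> y)"
    if "a \<in> carrier A" "b \<in> carrier A" for a b
    using that xy as[of "(a, \<zero>)" "(b, \<zero>)"] by (simp_all add: R_carrier R_mult)
  \<comment> \<open>Second component of an associator with one argument from each summand; applying
    \<open>star\<close> then makes \<open>x\<close> commute with \<open>a\<close>.\<close>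
  have "star a \<otimes> star x = star x \<otimes> star a" if "a \<in> carrier A" for a
    using that xy as(1)[of "(a, \<zero>)" "(\<zero>, \<one>)"] by (simp add: R_carrier R_mult star_mult)
  then have x2: "a \<otimes> x = x \<otimes> a" if "a \<in> carrier A" for a
    using that xy by (metis star_closed star_mult star_star)
  have "x \<in> C"
    unfolding center_iff using xy x1 x2 by (metis m_closed)
  have star1: "star \<one> = \<one>"
    using star_mult[of "star \<one>" \<one>] by simp
  \<comment> \<open>With both arguments in the second summand, the second component carries a factor
    \<alpha>, which is cancelled because \<alpha> is invertible.\<close>
  have "\<alpha> \<otimes> (y \<otimes> a) = \<alpha> \<otimes> (a \<otimes> y)" if "a \<in> carrier A" for a
    using that xy as(1)[of "(\<zero>, \<one>)" "(\<zero>, a)"] \<alpha>_center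
    by (simp add: R_carrier R_mult star1 star_mult star_\<alpha> center_comm[of \<alpha>] center_assoc[of \<alpha>] center_lcomm[of \<alpha>])
  then have y3: "a \<otimes> y = y \<otimes> a" if "a \<in> carrier A" for a
    using that xy by simp
  \<comment> \<open>The chain is \<open>(a b) y = b (a y) = a (b y) = (b a) y\<close>, where
    \<open>star a\<close> in \<open>y2\<close> removes the conjugation.\<close>
  have y4: "(a \<otimes> b) \<otimes> y = (b \<otimes> a) \<otimes> y" if "a \<in> carrier A" "b \<in> carrier A" for a b
    using that xy y1 y2[of "star a" b] y1[of b a] by simp
  have y5: "y \<otimes> (a \<otimes> b) = y \<otimes> (b \<otimes> a)" if "a \<in> carrier A" "b \<in> carrier A" for a b
    using that xy y4 by (simp add: y3)
  have y6: "b \<otimes> (y \<otimes> a) = y \<otimes> (b \<otimes> a)" if "a \<in> carrier A" "b \<in> carrier A" for a b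
    using that xy y1[of a b] y5[of a b] by (simp add: y3)
  have "y \<in> C"
    unfolding center_iff
  proof (intro conjI ballI)
    show "(y \<otimes> a) \<otimes> b = y \<otimes> (a \<otimes> b)" if "a \<in> carrier A" "b \<in> carrier A" for a b
    proof -
      \<comment> \<open>The argument \<open>star a\<close> cancels the conjugation in the product.
        After removing \<alpha>, \<open>(y a) b = (b a) y\<close>, and \<open>y5\<close> swaps
        \<open>a\<close> and \<open>b\<close>.\<close>
      have "\<alpha> \<otimes> ((y \<otimes> a) \<otimes> b) = \<alpha> \<otimes> ((b \<otimes> a) \<otimes> y)"
        using that xy as(1)[of "(\<zero>, star a)" "(\<zero>, b)"] \<alpha>_center
        by (simp add: R_carrier R_mult star_mult star_\<alpha> center_comm[of \<alpha>] center_assoc[of \<alpha>] center_lcomm[of \<alpha>])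
      then show ?thesis
        using that xy y5[of a b] by (simp add: y3)
    qed
  qed (use xy y3 y6 in auto)
  with y5 \<open>x \<in> C\<close> show "n \<in> C \<times> I"
    by (simp add: nxy annihilator_commutator_ideal)
qed

text \<open>Each term of the expanded products contains, besides \<alpha>, one of \<open>x\<close>,
  \<open>y\<close> or their conjugates and one component of each of the two other arguments,
  possibly conjugated. Moving the central factors to the front leaves a product of two elements, so
  no associativity of \<open>A\<close> is needed; under \<open>y\<close> or \<open>star y\<close>
  these two elements may be swapped.\<close>

lemma Times_subset_assoc_center_cayley_dickson: "C \<times> I \<subseteq> assoc_center R"
proof safe
  fix x y assume x: "x \<in> C" and y: "y \<in> I"
  have xC: "star x \<in> C" and yI: "star y \<in> I"
    using x y by (simp_all add: star_annihilator_commutator_ideal)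
  have yC: "y \<in> C" "star y \<in> C"
    and yc: "\<And>a b. a \<in> carrier A \<Longrightarrow> b \<in> carrier A \<Longrightarrow> y \<otimes> (a \<otimes> b) = y \<otimes> (b \<otimes> a)"
      "\<And>a b. a \<in> carrier A \<Longrightarrow> b \<in> carrier A \<Longrightarrow> star y \<otimes> (a \<otimes> b) = star y \<otimes> (b \<otimes> a)"
    using y yI by (auto simp: annihilator_commutator_ideal)
  have cen: "z \<in> carrier A \<and> (\<forall>a\<in>carrier A. a \<otimes> z = z \<otimes> a) \<and> (\<forall>a\<in>carrier A. \<forall>b\<in>carrier A.
      (z \<otimes> a) \<otimes> b = z \<otimes> (a \<otimes> b) \<and> a \<otimes> (z \<otimes> b) = z \<otimes> (a \<otimes> b))" if "z \<in> C" for z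
    using that unfolding center_iff by blast
  \<comment> \<open>Multiplication by \<open>\<alpha>\<close> is made opaque, since moving both \<open>\<alpha>\<close> and \<open>y\<close> to the front loops.\<close>
  define f where "f t = \<alpha> \<otimes> t" for t
  have f_simps: "f t \<in> carrier A" "star (f t) = f (star t)" "f t \<otimes> s = f (t \<otimes> s)"
    "s \<otimes> f t = f (s \<otimes> t)" "f (s \<oplus> t) = f s \<oplus> f t"
    if "s \<in> carrier A" "t \<in> carrier A" for s t
    using that \<alpha>_center
    by (simp_all add: f_def star_mult star_\<alpha> center_comm center_assoc center_lcomm r_distr)
  have m: "(a, b) \<otimes>\<^bsub>R\<^esub> (c, d) = (a \<otimes> c \<oplus> f (d \<otimes> star b), star a \<otimes> d \<oplus> c \<otimes> b)"
    if "a \<in> carrier A" "b \<in> carrier A" "c \<in> carrier A" "d \<in> carrier A" for a b c d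
    using that by (simp add: R_mult f_def)
  note s = m f_simps l_distr r_distr star_add star_mult a_ac cen[OF x] cen[OF xC] cen[OF yC(1)] cen[OF yC(2)] yc
  show "(x, y) \<in> assoc_center R"
    unfolding R.assoc_center_iff R_carrier
    by (auto simp: s)
qed

lemma assoc_center_cayley_dickson: "assoc_center R = C \<times> I"
  using assoc_center_cayley_dickson_subset Times_subset_assoc_center_cayley_dickson by blast

section \<open>N-essentiality of the Cayley-Dickson ring\<close>

text \<open>Left multiplication conjugates the scalar in the second component only. Using
  \<open>star e\<close> on the left makes both sides act on that component by
  \<open>e\<close>.\<close>

lemma R_mult_center:
  assumes "a \<in> carrier A" "b \<in> carrier A" "e \<in> C"
  shows "(star e, \<zero>) \<otimes>\<^bsub>R\<^esub> (a, b) = (star e \<otimes> a, e \<otimes> b)"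
    and "(a, b) \<otimes>\<^bsub>R\<^esub> (e, \<zero>) = (e \<otimes> a, e \<otimes> b)"
  using assms by (simp_all add: R_mult center_comm[of e])

text \<open>Merges the left and the right hypothesis, so that the necessity of the two conditions on
  \<open>A\<close> is proved only once.\<close>

lemma N_essentialD:
  assumes "left_N_essential R \<or> right_N_essential R" and r: "r \<in> carrier R" "r \<noteq> \<zero>\<^bsub>R\<^esub>"
  obtains x y where "x \<in> C" "y \<in> I"
    and "(x, y) \<otimes>\<^bsub>R\<^esub> r \<in> C \<times> I \<and> (x, y) \<otimes>\<^bsub>R\<^esub> r \<noteq> \<zero>\<^bsub>R\<^esub> \<or>
      r \<otimes>\<^bsub>R\<^esub> (x, y) \<in> C \<times> I \<and> r \<otimes>\<^bsub>R\<^esub> (x, y) \<noteq> \<zero>\<^bsub>R\<^esub>"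
proof -
  have z: "\<zero>\<^bsub>R\<^esub> \<in> assoc_center R"
    by (simp add: R.assoc_center_iff)
  have "\<exists>n\<in>assoc_center R. n \<otimes>\<^bsub>R\<^esub> r \<in> assoc_center R \<and> n \<otimes>\<^bsub>R\<^esub> r \<noteq> \<zero>\<^bsub>R\<^esub> \<or>
      r \<otimes>\<^bsub>R\<^esub> n \<in> assoc_center R \<and> r \<otimes>\<^bsub>R\<^esub> n \<noteq> \<zero>\<^bsub>R\<^esub>"
    using assms(1)
  proof
    assume "left_N_essential R"
    then have "(\<lambda>n. n \<otimes>\<^bsub>R\<^esub> r) ` assoc_center R \<inter> assoc_center R \<noteq> {\<zero>\<^bsub>R\<^esub>}"
      using r by (simp add: left_N_essential_def)
    moreover have "\<zero>\<^bsub>R\<^esub> \<in> (\<lambda>n. n \<otimes>\<^bsub>R\<^esub> r) ` assoc_center R \<inter> assoc_center R"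
      using r z by (auto intro!: image_eqI[OF _ z])
    ultimately show ?thesis by blast
  next
    assume "right_N_essential R"
    then have "(\<lambda>n. r \<otimes>\<^bsub>R\<^esub> n) ` assoc_center R \<inter> assoc_center R \<noteq> {\<zero>\<^bsub>R\<^esub>}"
      using r by (simp add: right_N_essential_def)
    moreover have "\<zero>\<^bsub>R\<^esub> \<in> (\<lambda>n. r \<otimes>\<^bsub>R\<^esub> n) ` assoc_center R \<inter> assoc_center R"
      using r z by (auto intro!: image_eqI[OF _ z])
    ultimately show ?thesis by blast
  qed
  then obtain n where n: "n \<in> C \<times> I" "n \<otimes>\<^bsub>R\<^esub> r \<in> C \<times> I \<and> n \<otimes>\<^bsub>R\<^esub> r \<noteq> \<zero>\<^bsub>R\<^esub> \<or>
      r \<otimes>\<^bsub>R\<^esub> n \<in> C \<times> I \<and> r \<otimes>\<^bsub>R\<^esub> n \<noteq> \<zero>\<^bsub>R\<^esub>"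
    unfolding assoc_center_cayley_dickson by (rule bexE)
  then show ?thesis
    using that[of "fst n" "snd n"] by (simp add: mem_Times_iff)
qed

lemma N_essential_imp:
  assumes N: "left_N_essential R \<or> right_N_essential R"
  shows "centrally_essential A \<and> essential_ideal I (center_ring A)"
proof
  have IC: "I \<subseteq> C"
    by (auto simp: annihilator_def)
  note [simp] = subsetD[OF IC] star_annihilator_commutator_ideal
  show "centrally_essential A"
    unfolding centrally_essential_def
  proof (intro ballI impI)
    fix a assume a: "a \<in> carrier A" "a \<noteq> \<zero>"
    obtain x y where xy: "x \<in> C" "y \<in> I" and
      *: "(x, y) \<otimes>\<^bsub>R\<^esub> (a, \<zero>) \<in> C \<times> I \<and> (x, y) \<otimes>\<^bsub>R\<^esub> (a, \<zero>) \<noteq> \<zero>\<^bsub>R\<^esub> \<or>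
        (a, \<zero>) \<otimes>\<^bsub>R\<^esub> (x, y) \<in> C \<times> I \<and> (a, \<zero>) \<otimes>\<^bsub>R\<^esub> (x, y) \<noteq> \<zero>\<^bsub>R\<^esub>"
      using N_essentialD[OF N, of "(a, \<zero>)"] a by (auto simp: R_carrier R_zero)
    have "star (star a \<otimes> y) = star y \<otimes> a"
      using a xy by (simp add: star_mult)
    then have "star a \<otimes> y \<in> I \<Longrightarrow> star y \<otimes> a \<in> C" "star a \<otimes> y \<noteq> \<zero> \<Longrightarrow> star y \<otimes> a \<noteq> \<zero>"
      using a xy star_center[of "star a \<otimes> y"] star_eq_zero[of "star a \<otimes> y"] by auto
    \<comment> \<open>The products of \<open>(a, 0)\<close> with \<open>(x, y)\<close> have
      components \<open>x a\<close>, \<open>y a\<close> and \<open>(star a) y\<close>. Whichever is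
      nonzero supplies the multiplier; the last is the conjugate of
      \<open>(star y) a\<close>.\<close>
    then have "\<exists>c\<in>{x, y, star y}. c \<otimes> a \<in> C \<and> c \<otimes> a \<noteq> \<zero>"
      using * a xy subsetD[OF IC, of y] subsetD[OF IC, of "y \<otimes> a"]
      by (auto simp: R_mult R_zero center_comm[of x a] center_comm[of y "star a"] center_comm[of y a])
    moreover have "{x, y, star y} \<subseteq> C"
      using xy by simp
    ultimately have "\<exists>c\<in>C. c \<otimes> a \<in> C \<and> c \<otimes> a \<noteq> \<zero>"
      by blast
    then show "(\<lambda>z. z \<otimes> a) ` C \<inter> C \<noteq> {\<zero>}" by auto
  qed
  show "essential_ideal I (center_ring A)"
    unfolding essential_ideal_def
  proof (intro conjI allI impI cring_center_ring ideal_annihilator_commutator_ideal)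
    fix J assume J: "ideal J (center_ring A) \<and> J \<noteq> {\<zero>\<^bsub>center_ring A\<^esub>}"
    then interpret J: ideal J "center_ring A" by simp
    interpret I: ideal I "center_ring A" by (rule ideal_annihilator_commutator_ideal)
    have "\<zero> \<in> J"
      using additive_subgroup.zero_closed[OF J.additive_subgroup_axioms] by (simp add: center_ring_def)
    with J obtain j where j: "j \<in> J" "j \<noteq> \<zero>"
      by (auto simp: center_ring_def)
    then have jC: "j \<in> C"
      using J.Icarr by (simp add: center_ring_def)
    obtain x y where xy: "x \<in> C" "y \<in> I" and
      *: "(x, y) \<otimes>\<^bsub>R\<^esub> (\<zero>, j) \<in> C \<times> I \<and> (x, y) \<otimes>\<^bsub>R\<^esub> (\<zero>, j) \<noteq> \<zero>\<^bsub>R\<^esub> \<or>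
        (\<zero>, j) \<otimes>\<^bsub>R\<^esub> (x, y) \<in> C \<times> I \<and> (\<zero>, j) \<otimes>\<^bsub>R\<^esub> (x, y) \<noteq> \<zero>\<^bsub>R\<^esub>"
      using N_essentialD[OF N, of "(\<zero>, j)"] j jC by (auto simp: R_carrier R_zero)
    have "star (y \<otimes> star j) = j \<otimes> star y" "star y \<otimes> j = j \<otimes> star y"
      using jC xy by (simp_all add: star_mult center_comm[of j])
    then have "y \<otimes> star j \<noteq> \<zero> \<Longrightarrow> star y \<otimes> j \<noteq> \<zero>"
      using jC xy star_eq_zero[of "y \<otimes> star j"] by auto
    \<comment> \<open>A nonzero second component is a multiple of \<open>j\<close> lying in
      \<open>I\<close>. A nonzero first component forces \<open>(star y) j\<close> to be nonzero,
      and this lies in \<open>I\<close> because \<open>star y\<close> does.\<close>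
    then obtain m where "m = star x \<otimes> j \<and> m \<in> I \<or> m = x \<otimes> j \<and> m \<in> I \<or> m = star y \<otimes> j" "m \<noteq> \<zero>"
      using * jC xy by (auto simp: R_mult R_zero center_comm[of j])
    then have "m \<in> I" "m \<in> J" "m \<noteq> \<zero>"
      using jC xy j I.I_r_closed[of "star y" j] J.I_l_closed[of j]
      by (auto simp: center_ring_def)
    then show "I \<inter> J \<noteq> {\<zero>\<^bsub>center_ring A\<^esub>}"
      by (auto simp: center_ring_def)
  qed
qed

text \<open>\<open>\<sigma>\<close> is \<open>star\<close> for multiplication from the left by \<open>(star e, 0)\<close> and the identity for
  multiplication from the right by \<open>(e, 0)\<close>.\<close>

lemma center_multiple:
  assumes ce: "centrally_essential A" and ess: "essential_ideal I (center_ring A)"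
    and \<sigma>: "\<And>x. x \<in> C \<Longrightarrow> \<sigma> x \<in> C" "\<And>x. x \<in> C \<Longrightarrow> \<sigma> (\<sigma> x) = x"
      "\<And>x y. x \<in> C \<Longrightarrow> y \<in> C \<Longrightarrow> \<sigma> (x \<otimes> y) = \<sigma> x \<otimes> \<sigma> y"
    and ab: "a \<in> carrier A" "b \<in> carrier A" "(a, b) \<noteq> (\<zero>, \<zero>)"
  obtains e where "e \<in> C" "\<sigma> e \<otimes> a \<in> C" "e \<otimes> b \<in> I" "(\<sigma> e \<otimes> a, e \<otimes> b) \<noteq> (\<zero>, \<zero>)"
proof -
  have I: "y \<in> C" if "y \<in> I" for y
    using that by (simp add: annihilator_def)
  have I0: "\<zero> \<in> I"
    by (simp add: annihilator_commutator_ideal)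
  \<comment> \<open>\<open>d\<close> settles the first component. For nonzero \<open>a\<close> it is
    the image under \<sigma> of a multiplier for \<open>a\<close>, since \<sigma> is its own inverse
    on \<open>C\<close>.\<close>
  obtain d where d: "d \<in> C" "\<sigma> d \<otimes> a \<in> C" "(\<sigma> d \<otimes> a, d \<otimes> b) \<noteq> (\<zero>, \<zero>)"
  proof (cases "a = \<zero>")
    case True
    then show ?thesis
      using that[of \<one>] ab \<sigma> by simp
  next
    case False
    then obtain c where "c \<in> C" "c \<otimes> a \<in> I" "c \<otimes> a \<noteq> \<zero>"
      using essential_multiple[OF ce ess ab(1)] by blast
    then show ?thesis
      using that[of "\<sigma> c"] \<sigma> I by simp
  qed
  show ?thesis
  proof (cases "d \<otimes> b = \<zero>")
    case True
    then show ?thesis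
      using that[of d] d I0 by simp
  next
    case False
    \<comment> \<open>Passing from \<open>d\<close> to \<open>c d\<close> may kill the first
      component but keeps it central; the second is now nonzero and in \<open>I\<close>.\<close>
    then obtain c where c: "c \<in> C" "c \<otimes> (d \<otimes> b) \<in> I" "c \<otimes> (d \<otimes> b) \<noteq> \<zero>"
      using essential_multiple[OF ce ess, of "d \<otimes> b"] d(1) ab by blast
    moreover have "\<sigma> (c \<otimes> d) \<otimes> a = \<sigma> c \<otimes> (\<sigma> d \<otimes> a)"
      using c(1) d(1) ab \<sigma> by (simp add: center_assoc)
    ultimately show ?thesis
      using that[of "c \<otimes> d"] d ab \<sigma> by (simp add: center_assoc)
  qed
qed

lemma imp_N_essential:
  assumes ce: "centrally_essential A" and ess: "essential_ideal I (center_ring A)"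
  shows "left_N_essential R" and "right_N_essential R"
proof -
  have I0: "\<zero> \<in> I"
    by (simp add: annihilator_commutator_ideal)
  show "left_N_essential R"
    unfolding left_N_essential_def
  proof (intro ballI impI)
    fix r assume "r \<in> carrier R" "r \<noteq> \<zero>\<^bsub>R\<^esub>"
    then obtain a b where ab: "r = (a, b)" "a \<in> carrier A" "b \<in> carrier A" "(a, b) \<noteq> (\<zero>, \<zero>)"
      by (cases r) (auto simp: R_carrier R_zero)
    obtain e where e: "e \<in> C" "star e \<otimes> a \<in> C" "e \<otimes> b \<in> I" "(star e \<otimes> a, e \<otimes> b) \<noteq> (\<zero>, \<zero>)"
      \<comment> \<open>\<open>star\<close> reverses products, hence is multiplicative on the
        commutative ring \<open>C\<close>.\<close>
      by (rule center_multiple[OF ce ess, of star a b]) (use ab in \<open>auto simp: star_mult center_comm\<close>)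
    have "(star e, \<zero>) \<otimes>\<^bsub>R\<^esub> r = (star e \<otimes> a, e \<otimes> b)"
      using ab e by (simp add: R_mult_center)
    moreover have "(star e, \<zero>) \<in> assoc_center R"
      using e I0 by (simp add: assoc_center_cayley_dickson)
    moreover have "(star e \<otimes> a, e \<otimes> b) \<in> assoc_center R"
      using e by (simp add: assoc_center_cayley_dickson)
    ultimately have "(star e \<otimes> a, e \<otimes> b) \<in> (\<lambda>n. n \<otimes>\<^bsub>R\<^esub> r) ` assoc_center R \<inter> assoc_center R"
      by (intro IntI image_eqI[OF sym])
    then show "(\<lambda>n. n \<otimes>\<^bsub>R\<^esub> r) ` assoc_center R \<inter> assoc_center R \<noteq> {\<zero>\<^bsub>R\<^esub>}"
      using e(4) unfolding R_zero by (metis singletonD)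
  qed
  show "right_N_essential R"
    unfolding right_N_essential_def
  proof (intro ballI impI)
    fix r assume "r \<in> carrier R" "r \<noteq> \<zero>\<^bsub>R\<^esub>"
    then obtain a b where ab: "r = (a, b)" "a \<in> carrier A" "b \<in> carrier A" "(a, b) \<noteq> (\<zero>, \<zero>)"
      by (cases r) (auto simp: R_carrier R_zero)
    obtain e where e: "e \<in> C" "e \<otimes> a \<in> C" "e \<otimes> b \<in> I" "(e \<otimes> a, e \<otimes> b) \<noteq> (\<zero>, \<zero>)"
      by (rule center_multiple[OF ce ess, of "\<lambda>x. x" a b]) (use ab in auto)
    have "r \<otimes>\<^bsub>R\<^esub> (e, \<zero>) = (e \<otimes> a, e \<otimes> b)"
      using ab e by (simp add: R_mult_center)
    moreover have "(e, \<zero>) \<in> assoc_center R"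
      using e I0 by (simp add: assoc_center_cayley_dickson)
    moreover have "(e \<otimes> a, e \<otimes> b) \<in> assoc_center R"
      using e by (simp add: assoc_center_cayley_dickson)
    ultimately have "(e \<otimes> a, e \<otimes> b) \<in> (\<lambda>n. r \<otimes>\<^bsub>R\<^esub> n) ` assoc_center R \<inter> assoc_center R"
      by (intro IntI image_eqI[OF sym])
    then show "(\<lambda>n. r \<otimes>\<^bsub>R\<^esub> n) ` assoc_center R \<inter> assoc_center R \<noteq> {\<zero>\<^bsub>R\<^esub>}"
      using e(4) unfolding R_zero by (metis singletonD)
  qed
qed

end

theorem theorem1p3:
  fixes A :: "('a, 'm) ring_scheme" and star :: "'a \<Rightarrow> 'a" and \<alpha> :: 'a
  assumes "involutive_ring A star"
    and "\<alpha> \<in> center A" and "\<alpha> \<in> Units A" and "star \<alpha> = \<alpha>"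
  defines "R \<equiv> cayley_dickson A star \<alpha>"
    and "C \<equiv> center A"
    and "I \<equiv> annihilator A (center A) (commutator_ideal A)"
  shows "assoc_center R = {(x, y). x \<in> C \<and> y \<in> I} \<and>
    (left_N_essential R \<longleftrightarrow> centrally_essential A \<and> essential_ideal I (center_ring A)) \<and>
    (right_N_essential R \<longleftrightarrow> centrally_essential A \<and> essential_ideal I (center_ring A))"
proof -
  interpret cayley_dickson_process A star \<alpha>
    using assms by (simp add: cayley_dickson_process_def cayley_dickson_process_axioms_def)
  show ?thesis
    unfolding R_def C_def I_def
  proof (intro conjI)
    show "assoc_center (cayley_dickson A star \<alpha>) =
        {(x, y). x \<in> center A \<and> y \<in> annihilator A (center A) (commutator_ideal A)}"
      by (simp add: assoc_center_cayley_dickson set_eq_iff)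
  qed (use N_essential_imp imp_N_essential in metis)+
qed

end
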